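(* Every intuitionistic modal multi-conclusion consequence relation is axiomatizable by stable canonical rules. That is, for every intuitionistic modal multi-conclusion consequence relation $M$ there is a set $\Sigma$ of stable canonical rules such that $M=\mathbf{IntK}_\Box^R\oplus\Sigma$.
   Context: Language and rules. Intuitionistic modal formulas are built from a fixed countably infinite set $Prop$ of propositional variables with $\wedge,\vee,\rightarrow,\top,\bot$ and a unary $\Box$; $\varphi\leftrightarrow\psi$ abbreviates $(\varphi\rightarrow\psi)\wedge(\psi\rightarrow\varphi)$. An intuitionistic modal multi-conclusion rule is a pair $\Gamma/\Delta$ of finite sets of such formulas (braces omitted for singletons, $/\varphi$ means $\emptyset/\{\varphi\}$). Logics and consequence relations. $\mathbf{IntK}_\Box$ is the least set of formulas closed under substitution that contains all theorems of intuitionistic propositional calculus and $\Box(\varphi\wedge\psi)\leftrightarrow(\Box\varphi\wedge\Box\psi)$, and is closed under modus ponens, $\varphi\rightarrow\psi \Rightarrow \Box\varphi\rightarrow\Box\psi$, and $\varphi\Rightarrow\Box\varphi$. An intuitionistic modal multi-conclusion consequence relation is a set $S$ of intuitionistic modal multi-conclusion rules such that: (i) $\Gamma/\Delta\in S$ implies $s[\Gamma]/s[\Delta]\in S$ for all substitutions $s$; (ii) $\varphi/\varphi\in S$ for all $\varphi$; (iii) $\Gamma/\Delta\in S$ implies $\Gamma\cup\Gamma'/\Delta\cup\Delta'\in S$ for all finite $\Gamma',\Delta'$; (iv) $\Gamma/\Delta\cup\{\varphi\}\in S$ and $\Gamma\cup\{\varphi\}/\Delta\in S$ imply $\Gamma/\Delta\in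 S$; (v) $/\varphi\in S$ for all $\varphi\in\mathbf{IntK}_\Box$; (vi) $\varphi/\Box\varphi\in S$ and $\{\varphi\rightarrow\psi,\varphi\}/\psi\in S$ for all $\varphi,\psi$. $\mathbf{IntK}_\Box^R$ is the least such relation, and $\mathbf{IntK}_\Box^R\oplus\Sigma$ is the least such relation containing the set of rules $\Sigma$. Stable canonical rules. A modal Heyting algebra is a pair $\mathfrak A=(A,\Box)$ where $A$ is a Heyting algebra, $\Box1=1$ and $\Box(a\wedge b)=\Box a\wedge\Box b$. Let $\mathfrak A=(A,\Box)$ be a finite modal Heyting algebra, $D^\rightarrow\subseteq A\times A$ and $D^\Box\subseteq A$. Take distinct propositional letters $p_a$ for $a\in A$. The stable canonical rule $\rho(\mathfrak A,D^\rightarrow,D^\Box)$ is the rule $\Gamma/\Delta$ with $\Gamma=\{p_{a\vee b}\leftrightarrow p_a\vee p_b\mid a,b\in A\}\cup\{p_{a\wedge b}\leftrightarrow p_a\wedge p_b\mid a,b\in A\}\cup\{p_0\leftrightarrow\bot,\ p_1\leftrightarrow\top\}\cup\{p_{\Box a}\rightarrow\Box p_a\mid a\in A\}\cup\{p_{a\rightarrow b}\leftrightarrow(p_a\rightarrow p_b)\mid (a,b)\in D^\rightarrow\}\cup\{\Box p_a\rightarrow p_{\Box a}\mid a\in D^\Box\}$ and $\Delta=\{p_a\leftrightarrow p_b\mid a\neq b\in A\}$. *)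

theory Defs
  imports "HOL-Algebra.Lattice"
begin

section \<open>Formulas and the logic IntK\<close>

type_synonym letter = nat

datatype fm =
    Var letter
  | Conj fm fm
  | Disj fm fm
  | Imp fm fm
  | Top
  | Bot
  | Box fm

definition Iff :: "fm \<Rightarrow> fm \<Rightarrow> fm" where
  "Iff \<phi> \<psi> = Conj (Imp \<phi> \<psi>) (Imp \<psi> \<phi>)"

primrec subst :: "(letter \<Rightarrow> fm) \<Rightarrow> fm \<Rightarrow> fm" where
  "subst s (Var p) = s p"
| "subst s (Conj \<phi> \<psi>) = Conj (subst s \<phi>) (subst s \<psi>)"
| "subst s (Disj \<phi> \<psi>) = Disj (subst s \<phi>) (subst s \<psi>)"
| "subst s (Imp \<phi> \<psi>) = Imp (subst s \<phi>) (subst s \<psi>)"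
| "subst s Top = Top"
| "subst s Bot = Bot"
| "subst s (Box \<phi>) = Box (subst s \<phi>)"

primrec box_free :: "fm \<Rightarrow> bool" where
  "box_free (Var p) \<longleftrightarrow> True"
| "box_free (Conj \<phi> \<psi>) \<longleftrightarrow> box_free \<phi> \<and> box_free \<psi>"
| "box_free (Disj \<phi> \<psi>) \<longleftrightarrow> box_free \<phi> \<and> box_free \<psi>"
| "box_free (Imp \<phi> \<psi>) \<longleftrightarrow> box_free \<phi> \<and> box_free \<psi>"
| "box_free Top \<longleftrightarrow> True"
| "box_free Bot \<longleftrightarrow> True"
| "box_free (Box \<phi>) \<longleftrightarrow> False"

inductive_set ipc_axioms :: "fm set" where
  "Imp \<phi> (Imp \<psi> \<phi>) \<in> ipc_axioms"
| "Imp (Imp \<phi> (Imp \<psi> \<chi>)) (Imp (Imp \<phi> \<psi>) (Imp \<phi> \<chi>)) \<in> ipc_axioms"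
| "Imp (Conj \<phi> \<psi>) \<phi> \<in> ipc_axioms"
| "Imp (Conj \<phi> \<psi>) \<psi> \<in> ipc_axioms"
| "Imp \<phi> (Imp \<psi> (Conj \<phi> \<psi>)) \<in> ipc_axioms"
| "Imp \<phi> (Disj \<phi> \<psi>) \<in> ipc_axioms"
| "Imp \<psi> (Disj \<phi> \<psi>) \<in> ipc_axioms"
| "Imp (Imp \<phi> \<chi>) (Imp (Imp \<psi> \<chi>) (Imp (Disj \<phi> \<psi>) \<chi>)) \<in> ipc_axioms"
| "Imp Bot \<phi> \<in> ipc_axioms"
| "Top \<in> ipc_axioms"

text \<open>Intuitionistic propositional calculus, in the language without box: only box-free axiom
  instances are admitted, so every theorem is box-free.\<close>

inductive_set ipc :: "fm set" where
  ipc_axiom: "\<phi> \<in> ipc_axioms \<Longrightarrow> box_free \<phi> \<Longrightarrow> \<phi> \<in> ipc"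
| ipc_mp: "Imp \<phi> \<psi> \<in> ipc \<Longrightarrow> \<phi> \<in> ipc \<Longrightarrow> \<psi> \<in> ipc"

inductive_set IntK :: "fm set" where
  IntK_subst: "\<phi> \<in> IntK \<Longrightarrow> subst s \<phi> \<in> IntK"
| IntK_ipc: "\<phi> \<in> ipc \<Longrightarrow> \<phi> \<in> IntK"
| IntK_box_conj: "Iff (Box (Conj \<phi> \<psi>)) (Conj (Box \<phi>) (Box \<psi>)) \<in> IntK"
| IntK_mp: "Imp \<phi> \<psi> \<in> IntK \<Longrightarrow> \<phi> \<in> IntK \<Longrightarrow> \<psi> \<in> IntK"
| IntK_mono: "Imp \<phi> \<psi> \<in> IntK \<Longrightarrow> Imp (Box \<phi>) (Box \<psi>) \<in> IntK"
| IntK_nec: "\<phi> \<in> IntK \<Longrightarrow> Box \<phi> \<in> IntK"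


section \<open>Multi-conclusion rules and consequence relations\<close>

type_synonym mrule = "fm set \<times> fm set"

definition is_rule :: "mrule \<Rightarrow> bool" where
  "is_rule r \<longleftrightarrow> finite (fst r) \<and> finite (snd r)"

definition consequence_relation :: "mrule set \<Rightarrow> bool" where
  "consequence_relation S \<longleftrightarrow>
     (\<forall>r\<in>S. is_rule r) \<and>
     (\<forall>\<Gamma> \<Delta> s. (\<Gamma>, \<Delta>) \<in> S \<longrightarrow> (subst s ` \<Gamma>, subst s ` \<Delta>) \<in> S) \<and>
     (\<forall>\<phi>. ({\<phi>}, {\<phi>}) \<in> S) \<and>
     (\<forall>\<Gamma> \<Delta> \<Gamma>' \<Delta>'. (\<Gamma>, \<Delta>) \<in> S \<longrightarrow> finite \<Gamma>' \<longrightarrow> finite \<Delta>' \<longrightarrow> (\<Gamma> \<union> \<Gamma>', \<Delta> \<union> \<Delta>') \<in> S) \<and>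
     (\<forall>\<Gamma> \<Delta> \<phi>. (\<Gamma>, \<Delta> \<union> {\<phi>}) \<in> S \<longrightarrow> (\<Gamma> \<union> {\<phi>}, \<Delta>) \<in> S \<longrightarrow> (\<Gamma>, \<Delta>) \<in> S) \<and>
     (\<forall>\<phi>\<in>IntK. ({}, {\<phi>}) \<in> S) \<and>
     (\<forall>\<phi>. ({\<phi>}, {Box \<phi>}) \<in> S) \<and>
     (\<forall>\<phi> \<psi>. ({Imp \<phi> \<psi>, \<phi>}, {\<psi>}) \<in> S)"

definition IntKR :: "mrule set" where
  "IntKR = \<Inter>{S. consequence_relation S}"

definition oplus :: "mrule set \<Rightarrow> mrule set \<Rightarrow> mrule set" (infixl "\<oplus>" 65) where
  "M \<oplus> \<Sigma> = \<Inter>{S. consequence_relation S \<and> M \<union> \<Sigma> \<subseteq> S}"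

text \<open>The two intersections really are least elements.\<close>

lemma consequence_relation_rules: "consequence_relation {r. is_rule r}"
  unfolding consequence_relation_def is_rule_def by simp

lemma consequence_relation_Inter:
  assumes "\<S> \<noteq> {}" and cr: "\<And>S. S \<in> \<S> \<Longrightarrow> consequence_relation S"
  shows "consequence_relation (\<Inter>\<S>)"
proof -
  note cr' = cr[unfolded consequence_relation_def]
  obtain S0 where S0: "S0 \<in> \<S>" using assms(1) by blast
  show ?thesis
    unfolding consequence_relation_def
  proof (intro conjI allI ballI impI InterI)
    fix r assume "r \<in> \<Inter>\<S>"
    then show "is_rule r" using cr'[THEN conjunct1, OF S0] S0 by blast
  next
    fix \<Gamma> \<Delta> s S assume "(\<Gamma>, \<Delta>) \<in> \<Inter>\<S>" "S \<in> \<S>"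
    then show "(subst s ` \<Gamma>, subst s ` \<Delta>) \<in> S"
      using cr'[THEN conjunct2, THEN conjunct1, of S] by blast
  next
    fix \<phi> S assume "S \<in> \<S>"
    then show "({\<phi>}, {\<phi>}) \<in> S" using cr'[THEN conjunct2, THEN conjunct2, THEN conjunct1, of S] by blast
  next
    fix \<Gamma> \<Delta> \<Gamma>' \<Delta>' :: "fm set" and S
    assume "(\<Gamma>, \<Delta>) \<in> \<Inter>\<S>" "finite \<Gamma>'" "finite \<Delta>'" "S \<in> \<S>"
    then show "(\<Gamma> \<union> \<Gamma>', \<Delta> \<union> \<Delta>') \<in> S"
      using cr'[THEN conjunct2, THEN conjunct2, THEN conjunct2, THEN conjunct1, of S] by blast
  next
    fix \<Gamma> \<Delta> \<phi> S
    assume *: "(\<Gamma>, \<Delta> \<union> {\<phi>}) \<in> \<Inter>\<S>" "(\<Gamma> \<union> {\<phi>}, \<Delta>) \<in> \<Inter>\<S>" "S \<in> \<S>"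
    show "(\<Gamma>, \<Delta>) \<in> S"
      by (rule cr'[THEN conjunct2, THEN conjunct2, THEN conjunct2, THEN conjunct2, THEN conjunct1, of S, rule_format, OF *(3) InterD[OF *(1,3)] InterD[OF *(2,3)]])
  next
    fix \<phi> S assume "\<phi> \<in> IntK" "S \<in> \<S>"
    then show "({}, {\<phi>}) \<in> S" using cr'[THEN conjunct2, THEN conjunct2, THEN conjunct2, THEN conjunct2, THEN conjunct2, THEN conjunct1, of S] by blast
  next
    fix \<phi> S assume "S \<in> \<S>"
    then show "({\<phi>}, {Box \<phi>}) \<in> S" using cr'[THEN conjunct2, THEN conjunct2, THEN conjunct2, THEN conjunct2, THEN conjunct2, THEN conjunct2, THEN conjunct1, of S] by blast
  next
    fix \<phi> \<psi> S assume "S \<in> \<S>"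
    then show "({Imp \<phi> \<psi>, \<phi>}, {\<psi>}) \<in> S" using cr'[THEN conjunct2, THEN conjunct2, THEN conjunct2, THEN conjunct2, THEN conjunct2, THEN conjunct2, THEN conjunct2, of S] by blast
  qed
qed

lemma consequence_relation_IntKR: "consequence_relation IntKR"
  unfolding IntKR_def
  by (rule consequence_relation_Inter) (use consequence_relation_rules in auto)

lemma consequence_relation_oplus:
  assumes "\<forall>r\<in>M \<union> \<Sigma>. is_rule r"
  shows "consequence_relation (M \<oplus> \<Sigma>)"
  unfolding oplus_def
proof (rule consequence_relation_Inter)
  show "{S. consequence_relation S \<and> M \<union> \<Sigma> \<subseteq> S} \<noteq> {}"
    using consequence_relation_rules assms by blast
qed auto

lemma IntKR_oplus: "IntKR \<oplus> \<Sigma> = \<Inter>{S. consequence_relation S \<and> \<Sigma> \<subseteq> S}"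
  unfolding oplus_def IntKR_def by blast


section \<open>Modal Heyting algebras and stable canonical rules\<close>

record 'a modal_alg = "'a gorder" +
  himp :: "'a \<Rightarrow> 'a \<Rightarrow> 'a"
  hbox :: "'a \<Rightarrow> 'a"

locale heyting_algebra = bounded_lattice L for L :: "('a, 'm) modal_alg_scheme" (structure) +
  assumes himp_closed: "a \<in> carrier L \<Longrightarrow> b \<in> carrier L \<Longrightarrow> himp L a b \<in> carrier L"
    and himp_residual: "a \<in> carrier L \<Longrightarrow> b \<in> carrier L \<Longrightarrow> c \<in> carrier L \<Longrightarrow>
          c \<sqsubseteq> himp L a b \<longleftrightarrow> c \<sqinter> a \<sqsubseteq> b"

locale modal_heyting_algebra = heyting_algebra L for L :: "('a, 'm) modal_alg_scheme" (structure) +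
  assumes hbox_closed: "a \<in> carrier L \<Longrightarrow> hbox L a \<in> carrier L"
    and hbox_top: "hbox L \<top> = \<top>"
    and hbox_meet: "a \<in> carrier L \<Longrightarrow> b \<in> carrier L \<Longrightarrow> hbox L (a \<sqinter> b) = hbox L a \<sqinter> hbox L b"

text \<open>The argument \<open>p\<close> assigns to each element its propositional letter.\<close>

definition stable_premises ::
    "('a \<Rightarrow> letter) \<Rightarrow> 'a modal_alg \<Rightarrow> ('a \<times> 'a) set \<Rightarrow> 'a set \<Rightarrow> fm set" where
  "stable_premises p L Dimp Dbox =
     {Iff (Var (p (a \<squnion>\<^bsub>L\<^esub> b))) (Disj (Var (p a)) (Var (p b))) | a b. a \<in> carrier L \<and> b \<in> carrier L} \<union>
     {Iff (Var (p (a \<sqinter>\<^bsub>L\<^esub> b))) (Conj (Var (p a)) (Var (p b))) | a b. a \<in> carrier L \<and> b \<in> carrier L} \<union>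
     {Iff (Var (p \<bottom>\<^bsub>L\<^esub>)) Bot, Iff (Var (p \<top>\<^bsub>L\<^esub>)) Top} \<union>
     {Imp (Var (p (hbox L a))) (Box (Var (p a))) | a. a \<in> carrier L} \<union>
     {Iff (Var (p (himp L a b))) (Imp (Var (p a)) (Var (p b))) | a b. (a, b) \<in> Dimp} \<union>
     {Imp (Box (Var (p a))) (Var (p (hbox L a))) | a. a \<in> Dbox}"

definition stable_conclusions :: "('a \<Rightarrow> letter) \<Rightarrow> 'a modal_alg \<Rightarrow> fm set" where
  "stable_conclusions p L =
     {Iff (Var (p a)) (Var (p b)) | a b. a \<in> carrier L \<and> b \<in> carrier L \<and> a \<noteq> b}"

definition stable_canonical_rule ::
    "('a \<Rightarrow> letter) \<Rightarrow> 'a modal_alg \<Rightarrow> ('a \<times> 'a) set \<Rightarrow> 'a set \<Rightarrow> mrule" where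
  "stable_canonical_rule p L Dimp Dbox = (stable_premises p L Dimp Dbox, stable_conclusions p L)"

text \<open>Every finite modal Heyting algebra is isomorphic to one whose carrier is a set of natural
  numbers, and a stable canonical rule depends only on the structure transported along \<open>p\<close>.
  Since \<open>p\<close> ranges over all injective assignments of letters, restricting the element type to
  \<^typ>\<open>nat\<close> loses no stable canonical rule.\<close>

definition stable_canonical_rules :: "mrule set" where
  "stable_canonical_rules =
     {stable_canonical_rule p L Dimp Dbox | (p :: nat \<Rightarrow> letter) L Dimp Dbox.
        modal_heyting_algebra L \<and> finite (carrier L) \<and> inj_on p (carrier L) \<and>
        Dimp \<subseteq> carrier L \<times> carrier L \<and> Dbox \<subseteq> carrier L}"

end

theory Submission
  imports Defs
begin

text \<open>
  Fix a consequence relation \<open>M\<close> and let \<open>\<Sigma>\<close> be the set of all stable canonical rules that belong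
  to \<open>M\<close>. Only \<open>M \<subseteq> IntKR \<oplus> \<Sigma>\<close> needs an argument. By a Lindenbaum construction, a rule outside a
  consequence relation \<open>S\<close> is refuted by a set \<open>T\<close> of formulas that obeys every rule of \<open>S\<close>
  (lemma \<open>refuting_theory\<close>); the formulas modulo provable equivalence in \<open>T\<close> are the modal Heyting
  algebra refuting the rule. Suppose \<open>\<Gamma>/\<Delta>\<close> lies outside \<open>IntKR \<oplus> \<Sigma>\<close>, and take such a \<open>T\<close>.

  The algebra of \<open>T\<close> may be infinite, but the sublattice generated by the subformulas of \<open>\<Gamma>/\<Delta>\<close> is a
  finite distributive lattice. It becomes a modal Heyting algebra when \<open>a \<rightarrow> b\<close> and \<open>\<box>a\<close> are
  replaced by the largest lattice elements below them. The replacement changes nothing where the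
  value already lies in the sublattice, as it does for all subformulas; the sets
  \<open>D\<^sup>\<rightarrow>\<close> and \<open>D\<^sup>\<box>\<close> record where the values agree. Elsewhere the inequality \<open>\<box>'a \<le> \<box>a\<close>
  survives, and this is what the stable canonical rule of the finite algebra expresses. Hence \<open>T\<close>
  refutes that rule (lemma \<open>refuted_stable_rule\<close>), so the rule is not in \<open>\<Sigma>\<close>, hence not in \<open>M\<close>.

  Conversely the stable canonical rule encodes enough of the finite algebra to carry the refutation
  of \<open>\<Gamma>/\<Delta>\<close> back into any theory that refutes the encoding: substitute for each letter the letter
  of its value. So \<open>\<Gamma>/\<Delta>\<close> is not in \<open>M\<close> either (lemma \<open>stable_rule_from_rule\<close>).

  To compute in the algebra of \<open>T\<close>, a formula is represented by the set of prime theories above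
  \<open>T\<close> that contain it; conjunction and disjunction then become intersection and union.
\<close>

section \<open>Theories obeying a consequence relation\<close>

lemma consequence_relationD:
  assumes "consequence_relation S"
  shows cr_finite: "(\<Gamma>, \<Delta>) \<in> S \<Longrightarrow> finite \<Gamma> \<and> finite \<Delta>"
    and cr_subst: "(\<Gamma>, \<Delta>) \<in> S \<Longrightarrow> (subst s ` \<Gamma>, subst s ` \<Delta>) \<in> S"
    and cr_refl: "({\<phi>}, {\<phi>}) \<in> S"
    and cr_weaken: "(\<Gamma>, \<Delta>) \<in> S \<Longrightarrow> finite \<Gamma>' \<Longrightarrow> finite \<Delta>' \<Longrightarrow> (\<Gamma> \<union> \<Gamma>', \<Delta> \<union> \<Delta>') \<in> S"
    and cr_cut: "(\<Gamma>, \<Delta> \<union> {\<phi>}) \<in> S \<Longrightarrow> (\<Gamma> \<union> {\<phi>}, \<Delta>) \<in> S \<Longrightarrow> (\<Gamma>, \<Delta>) \<in> S"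
    and cr_IntK: "\<phi> \<in> IntK \<Longrightarrow> ({}, {\<phi>}) \<in> S"
    and cr_nec: "({\<phi>}, {Box \<phi>}) \<in> S"
    and cr_mp: "({Imp \<phi> \<psi>, \<phi>}, {\<psi>}) \<in> S"
proof -
  note cr = assms[unfolded consequence_relation_def is_rule_def]
  show "(\<Gamma>, \<Delta>) \<in> S \<Longrightarrow> finite \<Gamma> \<and> finite \<Delta>"
    using cr[THEN conjunct1] by fastforce
  show "(\<Gamma>, \<Delta>) \<in> S \<Longrightarrow> (subst s ` \<Gamma>, subst s ` \<Delta>) \<in> S"
    using cr[THEN conjunct2, THEN conjunct1] by blast
  show "({\<phi>}, {\<phi>}) \<in> S"
    using cr[THEN conjunct2, THEN conjunct2, THEN conjunct1] by blast
  show "(\<Gamma>, \<Delta>) \<in> S \<Longrightarrow> finite \<Gamma>' \<Longrightarrow> finite \<Delta>' \<Longrightarrow> (\<Gamma> \<union> \<Gamma>', \<Delta> \<union> \<Delta>') \<in> S"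
    using cr[THEN conjunct2, THEN conjunct2, THEN conjunct2, THEN conjunct1] by blast
  show "(\<Gamma>, \<Delta> \<union> {\<phi>}) \<in> S \<Longrightarrow> (\<Gamma> \<union> {\<phi>}, \<Delta>) \<in> S \<Longrightarrow> (\<Gamma>, \<Delta>) \<in> S"
    using cr[THEN conjunct2, THEN conjunct2, THEN conjunct2, THEN conjunct2, THEN conjunct1] by blast
  show "\<phi> \<in> IntK \<Longrightarrow> ({}, {\<phi>}) \<in> S"
    using cr[THEN conjunct2, THEN conjunct2, THEN conjunct2, THEN conjunct2, THEN conjunct2, THEN conjunct1] by blast
  show "({\<phi>}, {Box \<phi>}) \<in> S"
    using cr[THEN conjunct2, THEN conjunct2, THEN conjunct2, THEN conjunct2, THEN conjunct2, THEN conjunct2, THEN conjunct1] by blast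
  show "({Imp \<phi> \<psi>, \<phi>}, {\<psi>}) \<in> S"
    using cr[THEN conjunct2, THEN conjunct2, THEN conjunct2, THEN conjunct2, THEN conjunct2, THEN conjunct2, THEN conjunct2] by blast
qed

definition obeys :: "fm set \<Rightarrow> mrule \<Rightarrow> bool" where
  "obeys T r \<longleftrightarrow> (fst r \<subseteq> T \<longrightarrow> snd r \<inter> T \<noteq> {})"

lemma cr_weaken_subset:
  assumes "consequence_relation S" "(\<Gamma>, \<Delta>) \<in> S" "\<Gamma> \<subseteq> \<Gamma>'" "\<Delta> \<subseteq> \<Delta>'" "finite \<Gamma>'" "finite \<Delta>'"
  shows "(\<Gamma>', \<Delta>') \<in> S"
  using cr_weaken[OF assms(1,2,5,6)] assms(3,4) by (simp add: Un_absorb1)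

lemma cut_many:
  assumes S: "consequence_relation S" and "finite D" "finite G" "finite \<Delta>"
    and "(G, \<Delta> \<union> D) \<in> S" and "\<And>d. d \<in> D \<Longrightarrow> (G \<union> {d}, \<Delta>) \<in> S"
  shows "(G, \<Delta>) \<in> S"
  using assms(2,5,6)
proof (induction D)
  case empty
  then show ?case by simp
next
  case (insert d D)
  have "(G \<union> {d}, \<Delta> \<union> D) \<in> S"
    by (rule cr_weaken_subset[OF S insert.prems(2)[of d]]) (use insert.hyps assms(3,4) in auto)
  then have "(G, \<Delta> \<union> D) \<in> S"
    using cr_cut[OF S, of G "\<Delta> \<union> D" d] insert.prems(1) by (simp add: Un_insert_right)
  then show ?case using insert.IH insert.prems(2) by blast
qed

text \<open>A set \<open>T\<close> that is maximal among those not yielding \<open>\<Delta>\<close> obeys all of \<open>S\<close>: if a rule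
  \<open>G/D\<close> were violated, then each \<open>d \<in> D\<close> would yield \<open>\<Delta>\<close> together with finitely many members of
  \<open>T\<close>, and cutting away all of \<open>D\<close> would let \<open>T\<close> itself yield \<open>\<Delta>\<close>.\<close>

lemma refuting_theory:
  assumes S: "consequence_relation S" and fin: "finite \<Gamma>" "finite \<Delta>" and notin: "(\<Gamma>, \<Delta>) \<notin> S"
  obtains T where "\<forall>r\<in>S. obeys T r" "\<Gamma> \<subseteq> T" "\<Delta> \<inter> T = {}"
proof -
  define F where "F = {T. \<Gamma> \<subseteq> T \<and> (\<forall>G. finite G \<longrightarrow> G \<subseteq> T \<longrightarrow> (G, \<Delta>) \<notin> S)}"
  have "\<Gamma> \<in> F"
    unfolding F_def using notin cr_weaken_subset[OF S] fin by blast
  moreover have "\<Union>C \<in> F" if "C \<noteq> {}" "subset.chain F C" for C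
  proof -
    have CF: "C \<subseteq> F" using that(2) by (simp add: subset_chain_def)
    have "(G, \<Delta>) \<notin> S" if G: "finite G" "G \<subseteq> \<Union>C" for G
    proof -
      obtain X where "X \<in> C" "G \<subseteq> X"
        by (rule finite_subset_Union_chain[OF G \<open>C \<noteq> {}\<close> \<open>subset.chain F C\<close>])
      then show ?thesis using CF G(1) unfolding F_def by blast
    qed
    moreover have "\<Gamma> \<subseteq> \<Union>C" using CF that(1) unfolding F_def by blast
    ultimately show ?thesis unfolding F_def by blast
  qed
  ultimately obtain T where T: "T \<in> F" and max: "\<And>X. X \<in> F \<Longrightarrow> T \<subseteq> X \<Longrightarrow> X = T"
    using subset_Zorn_nonempty[of F] by (metis empty_iff)
  have *: "\<exists>G. finite G \<and> G \<subseteq> T \<and> (G \<union> {d}, \<Delta>) \<in> S" if "d \<notin> T" for d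
  proof -
    have "insert d T \<notin> F" using max[of "insert d T"] that by blast
    then obtain G where G: "finite G" "G \<subseteq> insert d T" "(G, \<Delta>) \<in> S"
      using T unfolding F_def by blast
    have "(G - {d} \<union> {d}, \<Delta>) \<in> S"
      by (rule cr_weaken_subset[OF S G(3)]) (use G fin in auto)
    then show ?thesis using G by (intro exI[of _ "G - {d}"]) auto
  qed
  have "obeys T r" if "r \<in> S" for r
  proof (rule ccontr)
    assume viol: "\<not> obeys T r"
    obtain G D where r: "r = (G, D)" by force
    have GD: "(G, D) \<in> S" "G \<subseteq> T" "D \<inter> T = {}"
      using viol that r unfolding obeys_def by auto
    then have finGD: "finite G" "finite D" using cr_finite[OF S] by auto
    obtain H where H: "\<And>d. d \<in> D \<Longrightarrow> finite (H d) \<and> H d \<subseteq> T \<and> (H d \<union> {d}, \<Delta>) \<in> S"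
      using * GD(3) by (metis disjoint_iff)
    define K where "K = G \<union> \<Union>(H ` D)"
    have K: "finite K" "K \<subseteq> T" using H finGD GD unfolding K_def by auto
    have "(K, \<Delta>) \<in> S"
    proof (rule cut_many[OF S finGD(2) K(1) fin(2)])
      show "(K, \<Delta> \<union> D) \<in> S"
        by (rule cr_weaken_subset[OF S GD(1)]) (use K finGD fin in \<open>auto simp: K_def\<close>)
      show "(K \<union> {d}, \<Delta>) \<in> S" if "d \<in> D" for d
        by (rule cr_weaken_subset[OF S conjunct2[OF conjunct2[OF H[OF that]]]])
          (use K fin that in \<open>auto simp: K_def\<close>)
    qed
    then show False using T K unfolding F_def by blast
  qed
  moreover have "\<Delta> \<inter> T = {}"
  proof (rule ccontr)
    assume "\<Delta> \<inter> T \<noteq> {}"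
    then obtain d where d: "d \<in> \<Delta>" "d \<in> T" by blast
    have "({d}, \<Delta>) \<in> S"
      by (rule cr_weaken_subset[OF S cr_refl[OF S, of d]]) (use d fin in auto)
    then show False using T d unfolding F_def by blast
  qed
  moreover have "\<Gamma> \<subseteq> T" using T unfolding F_def by blast
  ultimately show thesis by (intro that[of T]) blast
qed


section \<open>Intuitionistic theories and their prime extensions\<close>

definition ipc_theory :: "fm set \<Rightarrow> bool" where
  "ipc_theory Q \<longleftrightarrow> ipc_axioms \<subseteq> Q \<and> (\<forall>\<phi> \<psi>. Imp \<phi> \<psi> \<in> Q \<longrightarrow> \<phi> \<in> Q \<longrightarrow> \<psi> \<in> Q)"

definition prime_theory :: "fm set \<Rightarrow> bool" where
  "prime_theory Q \<longleftrightarrow>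
     ipc_theory Q \<and> Bot \<notin> Q \<and> (\<forall>\<phi> \<psi>. Disj \<phi> \<psi> \<in> Q \<longrightarrow> \<phi> \<in> Q \<or> \<psi> \<in> Q)"

lemma ipc_theory_mp: "ipc_theory Q \<Longrightarrow> Imp \<phi> \<psi> \<in> Q \<Longrightarrow> \<phi> \<in> Q \<Longrightarrow> \<psi> \<in> Q"
  unfolding ipc_theory_def by blast

lemma ipc_theory_axiom: "ipc_theory Q \<Longrightarrow> \<phi> \<in> ipc_axioms \<Longrightarrow> \<phi> \<in> Q"
  unfolding ipc_theory_def by blast

lemma ipc_theory_K: "ipc_theory Q \<Longrightarrow> \<psi> \<in> Q \<Longrightarrow> Imp \<phi> \<psi> \<in> Q"
  by (rule ipc_theory_mp[OF _ ipc_theory_axiom[OF _ ipc_axioms.intros(1)]])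

lemma ipc_theory_S:
  "ipc_theory Q \<Longrightarrow> Imp \<phi> (Imp \<psi> \<chi>) \<in> Q \<Longrightarrow> Imp \<phi> \<psi> \<in> Q \<Longrightarrow> Imp \<phi> \<chi> \<in> Q"
  by (metis ipc_axioms.intros(2) ipc_theory_axiom ipc_theory_mp)

lemma ipc_theory_refl: "ipc_theory Q \<Longrightarrow> Imp \<phi> \<phi> \<in> Q"
  by (metis ipc_axioms.intros(1) ipc_theory_axiom ipc_theory_S)

lemma ipc_theory_Conj: "ipc_theory Q \<Longrightarrow> Conj \<phi> \<psi> \<in> Q \<longleftrightarrow> \<phi> \<in> Q \<and> \<psi> \<in> Q"
  by (metis ipc_axioms.intros(3-5) ipc_theory_axiom ipc_theory_mp)

lemma ipc_theory_Iff: "ipc_theory Q \<Longrightarrow> Iff \<phi> \<psi> \<in> Q \<longleftrightarrow> Imp \<phi> \<psi> \<in> Q \<and> Imp \<psi> \<phi> \<in> Q"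
  unfolding Iff_def by (rule ipc_theory_Conj)

text \<open>The deduction theorem: the consequences of \<open>\<phi>\<close> over a theory form a theory that extends it
  by \<open>\<phi>\<close>.\<close>

lemma ipc_theory_deduction:
  assumes "ipc_theory Q"
  shows "ipc_theory {\<psi>. Imp \<phi> \<psi> \<in> Q}" "Q \<subseteq> {\<psi>. Imp \<phi> \<psi> \<in> Q}" "\<phi> \<in> {\<psi>. Imp \<phi> \<psi> \<in> Q}"
proof -
  show "Q \<subseteq> {\<psi>. Imp \<phi> \<psi> \<in> Q}" using ipc_theory_K[OF assms] by blast
  show "\<phi> \<in> {\<psi>. Imp \<phi> \<psi> \<in> Q}" using ipc_theory_refl[OF assms] by blast
  show "ipc_theory {\<psi>. Imp \<phi> \<psi> \<in> Q}"
    unfolding ipc_theory_def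
    using ipc_theory_K[OF assms] ipc_theory_axiom[OF assms] ipc_theory_S[OF assms] by blast
qed

lemma prime_theory_Disj: "prime_theory Q \<Longrightarrow> Disj \<phi> \<psi> \<in> Q \<longleftrightarrow> \<phi> \<in> Q \<or> \<psi> \<in> Q"
  unfolding prime_theory_def by (metis ipc_axioms.intros(6,7) ipc_theory_axiom ipc_theory_mp)

text \<open>A theory maximal among those containing \<open>\<phi>\<close> but not \<open>\<psi>\<close> is prime, for if neither disjunct
  belonged to it, then by maximality both would imply \<open>\<psi>\<close> in it.\<close>

lemma prime_extension:
  assumes T: "ipc_theory T" and notin: "Imp \<phi> \<psi> \<notin> T"
  obtains Q where "prime_theory Q" "T \<subseteq> Q" "\<phi> \<in> Q" "\<psi> \<notin> Q"
proof -
  define F where "F = {Q. ipc_theory Q \<and> T \<subseteq> Q \<and> \<phi> \<in> Q \<and> \<psi> \<notin> Q}"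
  have "{\<chi>. Imp \<phi> \<chi> \<in> T} \<in> F"
    unfolding F_def using ipc_theory_deduction[OF T] notin by simp
  moreover have "\<Union>C \<in> F" if C: "C \<noteq> {}" "subset.chain F C" for C
  proof -
    have CF: "C \<subseteq> F" using that(2) by (simp add: subset_chain_def)
    have "\<beta> \<in> \<Union>C" if ab: "Imp \<alpha> \<beta> \<in> \<Union>C" "\<alpha> \<in> \<Union>C" for \<alpha> \<beta>
    proof -
      have fin: "finite {Imp \<alpha> \<beta>, \<alpha>}" and sub: "{Imp \<alpha> \<beta>, \<alpha>} \<subseteq> \<Union>C" using ab by auto
      obtain X where X: "X \<in> C" "{Imp \<alpha> \<beta>, \<alpha>} \<subseteq> X"
        by (rule finite_subset_Union_chain[OF fin sub C])
      then have "ipc_theory X" using CF unfolding F_def by blast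
      then show ?thesis using X ipc_theory_mp by blast
    qed
    then show ?thesis using CF C(1) unfolding F_def ipc_theory_def by blast
  qed
  ultimately obtain Q where Q: "Q \<in> F" and max: "\<And>X. X \<in> F \<Longrightarrow> Q \<subseteq> X \<Longrightarrow> X = Q"
    using subset_Zorn_nonempty[of F] by (metis empty_iff)
  have thQ: "ipc_theory Q" using Q unfolding F_def by blast
  have *: "Imp \<alpha> \<psi> \<in> Q" if "\<alpha> \<notin> Q" for \<alpha>
  proof (rule ccontr)
    assume "Imp \<alpha> \<psi> \<notin> Q"
    then have "{\<chi>. Imp \<alpha> \<chi> \<in> Q} \<in> F"
      using Q ipc_theory_deduction[OF thQ, of \<alpha>] unfolding F_def by blast
    then show False using max[of "{\<chi>. Imp \<alpha> \<chi> \<in> Q}"] ipc_theory_deduction[OF thQ, of \<alpha>] that by blast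
  qed
  have "Bot \<notin> Q"
    using Q ipc_theory_mp[OF thQ ipc_theory_axiom[OF thQ ipc_axioms.intros(9)], of \<psi>]
    unfolding F_def by blast
  moreover have "\<alpha> \<in> Q \<or> \<beta> \<in> Q" if "Disj \<alpha> \<beta> \<in> Q" for \<alpha> \<beta>
  proof (rule ccontr)
    assume "\<not> (\<alpha> \<in> Q \<or> \<beta> \<in> Q)"
    then have "Imp \<alpha> \<psi> \<in> Q" "Imp \<beta> \<psi> \<in> Q" using * by auto
    then have "\<psi> \<in> Q"
      using that by (metis ipc_axioms.intros(8) ipc_theory_axiom[OF thQ] ipc_theory_mp[OF thQ])
    then show False using Q unfolding F_def by blast
  qed
  ultimately show thesis using that Q unfolding F_def prime_theory_def by blast
qed

definition truth_set :: "fm set \<Rightarrow> fm \<Rightarrow> fm set set" where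
  "truth_set T \<phi> = {Q. prime_theory Q \<and> T \<subseteq> Q \<and> \<phi> \<in> Q}"

lemma truth_set_subset_iff:
  assumes "ipc_theory T"
  shows "truth_set T \<phi> \<subseteq> truth_set T \<psi> \<longleftrightarrow> Imp \<phi> \<psi> \<in> T"
proof
  assume "truth_set T \<phi> \<subseteq> truth_set T \<psi>"
  then show "Imp \<phi> \<psi> \<in> T"
    using prime_extension[OF assms, of \<phi> \<psi>] unfolding truth_set_def by blast
next
  assume "Imp \<phi> \<psi> \<in> T"
  then show "truth_set T \<phi> \<subseteq> truth_set T \<psi>"
    unfolding truth_set_def prime_theory_def using ipc_theory_mp by blast
qed

lemma truth_set_eq_iff:
  "ipc_theory T \<Longrightarrow> truth_set T \<phi> = truth_set T \<psi> \<longleftrightarrow> Iff \<phi> \<psi> \<in> T"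
  by (simp add: ipc_theory_Iff set_eq_subset truth_set_subset_iff)

lemma truth_set_Conj: "truth_set T (Conj \<phi> \<psi>) = truth_set T \<phi> \<inter> truth_set T \<psi>"
  unfolding truth_set_def prime_theory_def using ipc_theory_Conj by blast

lemma truth_set_Disj: "truth_set T (Disj \<phi> \<psi>) = truth_set T \<phi> \<union> truth_set T \<psi>"
  unfolding truth_set_def using prime_theory_Disj by blast

lemma truth_set_Bot: "truth_set T Bot = {}"
  unfolding truth_set_def prime_theory_def by blast

lemma truth_set_subset_Top: "truth_set T \<phi> \<subseteq> truth_set T Top"
  unfolding truth_set_def prime_theory_def using ipc_theory_axiom ipc_axioms.intros(10) by blast

lemma truth_set_eq_Top_iff:
  assumes "ipc_theory T"
  shows "truth_set T \<phi> = truth_set T Top \<longleftrightarrow> \<phi> \<in> T"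
  using assms ipc_axioms.intros(10)
  by (metis ipc_theory_K ipc_theory_axiom ipc_theory_mp truth_set_subset_Top subset_antisym
      order_refl truth_set_subset_iff)

lemma truth_set_residual:
  assumes T: "ipc_theory T"
  shows "truth_set T \<chi> \<subseteq> truth_set T (Imp \<phi> \<psi>) \<longleftrightarrow> truth_set T \<chi> \<inter> truth_set T \<phi> \<subseteq> truth_set T \<psi>"
proof
  assume "truth_set T \<chi> \<subseteq> truth_set T (Imp \<phi> \<psi>)"
  then show "truth_set T \<chi> \<inter> truth_set T \<phi> \<subseteq> truth_set T \<psi>"
    unfolding truth_set_def prime_theory_def using ipc_theory_mp by blast
next
  assume "truth_set T \<chi> \<inter> truth_set T \<phi> \<subseteq> truth_set T \<psi>"
  then have "Imp (Conj \<chi> \<phi>) \<psi> \<in> T"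
    by (simp flip: truth_set_Conj add: truth_set_subset_iff[OF T])
  (* adjoin first \<chi> and then \<phi>, and apply the deduction theorem twice *)
  moreover define T1 where "T1 = {\<alpha>. Imp \<chi> \<alpha> \<in> T}"
  moreover define T2 where "T2 = {\<alpha>. Imp \<phi> \<alpha> \<in> T1}"
  ultimately have "ipc_theory T2" "Imp (Conj \<chi> \<phi>) \<psi> \<in> T2" "\<chi> \<in> T2" "\<phi> \<in> T2"
    using ipc_theory_deduction[OF T] ipc_theory_deduction[of T1] by blast+
  then have "\<psi> \<in> T2" using ipc_theory_Conj ipc_theory_mp by blast
  then show "truth_set T \<chi> \<subseteq> truth_set T (Imp \<phi> \<psi>)"
    unfolding truth_set_subset_iff[OF T] T1_def T2_def by blast
qed

section \<open>Modal theories\<close>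

text \<open>The calculus supplies the axioms only without boxes; closure under substitution provides
  all their instances.\<close>

lemma ipc_axioms_subset_IntK: "ipc_axioms \<subseteq> IntK"
proof
  have inst: "subst ((!) ps) \<phi> \<in> IntK" if "\<phi> \<in> ipc_axioms" "box_free \<phi>" for \<phi> ps
    using that by (intro IntK_subst IntK_ipc ipc_axiom)
  fix \<phi> assume "\<phi> \<in> ipc_axioms"
  then show "\<phi> \<in> IntK"
  proof cases
    case (1 \<phi> \<psi>)
    then show ?thesis using inst[OF ipc_axioms.intros(1)[of "Var 0" "Var 1"], of "[\<phi>, \<psi>]"] by simp
  next
    case (2 \<phi> \<psi> \<chi>)
    then show ?thesis
      using inst[OF ipc_axioms.intros(2)[of "Var 0" "Var 1" "Var 2"], of "[\<phi>, \<psi>, \<chi>]"] by simp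
  next
    case (3 \<phi> \<psi>)
    then show ?thesis using inst[OF ipc_axioms.intros(3)[of "Var 0" "Var 1"], of "[\<phi>, \<psi>]"] by simp
  next
    case (4 \<phi> \<psi>)
    then show ?thesis using inst[OF ipc_axioms.intros(4)[of "Var 0" "Var 1"], of "[\<phi>, \<psi>]"] by simp
  next
    case (5 \<phi> \<psi>)
    then show ?thesis using inst[OF ipc_axioms.intros(5)[of "Var 0" "Var 1"], of "[\<phi>, \<psi>]"] by simp
  next
    case (6 \<phi> \<psi>)
    then show ?thesis using inst[OF ipc_axioms.intros(6)[of "Var 0" "Var 1"], of "[\<phi>, \<psi>]"] by simp
  next
    case (7 \<psi> \<phi>)
    then show ?thesis using inst[OF ipc_axioms.intros(7)[of "Var 0" "Var 1"], of "[\<psi>, \<phi>]"] by simp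
  next
    case (8 \<phi> \<chi> \<psi>)
    then show ?thesis
      using inst[OF ipc_axioms.intros(8)[of "Var 0" "Var 1" "Var 2"], of "[\<phi>, \<chi>, \<psi>]"] by simp
  next
    case (9 \<phi>)
    then show ?thesis using inst[OF ipc_axioms.intros(9)[of "Var 0"], of "[\<phi>]"] by simp
  next
    case 10
    then show ?thesis using inst[OF ipc_axioms.intros(10)] by simp
  qed
qed

lemma ipc_theory_IntK: "ipc_theory IntK"
  unfolding ipc_theory_def using ipc_axioms_subset_IntK IntK_mp by blast

locale modal_theory =
  fixes T :: "fm set"
  assumes IntK_subset: "IntK \<subseteq> T"
    and mp: "Imp \<phi> \<psi> \<in> T \<Longrightarrow> \<phi> \<in> T \<Longrightarrow> \<psi> \<in> T"
    and nec: "\<phi> \<in> T \<Longrightarrow> Box \<phi> \<in> T"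
begin

lemma ipc_theory: "ipc_theory T"
  unfolding ipc_theory_def using ipc_axioms_subset_IntK IntK_subset mp by blast

abbreviation U :: "fm \<Rightarrow> fm set set" where "U \<equiv> truth_set T"

lemmas U_subset_iff = truth_set_subset_iff[OF ipc_theory]
lemmas U_eq_iff = truth_set_eq_iff[OF ipc_theory]
lemmas U_eq_Top_iff = truth_set_eq_Top_iff[OF ipc_theory]
lemmas U_residual = truth_set_residual[OF ipc_theory]

lemma U_Box_Top: "U (Box Top) = U Top"
  using U_eq_Top_iff nec by blast

lemma U_Box_Conj: "U (Box (Conj \<phi> \<psi>)) = U (Box \<phi>) \<inter> U (Box \<psi>)"
proof -
  have "Iff (Box (Conj \<phi> \<psi>)) (Conj (Box \<phi>) (Box \<psi>)) \<in> T"
    using IntK_box_conj IntK_subset by blast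
  then show ?thesis using U_eq_iff truth_set_Conj by metis
qed

text \<open>The monotonicity rule of the logic applies to its theorems only, not to the members of \<open>T\<close>.
  For the latter it follows by necessitation, as in the derivation of the axiom
  \<open>\<box>(\<phi> \<rightarrow> \<psi>) \<rightarrow> (\<box>\<phi> \<rightarrow> \<box>\<psi>)\<close>.\<close>

lemma U_Box_mono:
  assumes "U \<phi> \<subseteq> U \<psi>"
  shows "U (Box \<phi>) \<subseteq> U (Box \<psi>)"
proof -
  let ?c = "Conj (Imp \<phi> \<psi>) \<phi>"
  have "Imp ?c \<psi> \<in> IntK"
    using ipc_theory_deduction[OF ipc_theory_IntK, of ?c] ipc_theory_Conj ipc_theory_mp by blast
  then have "Imp (Box ?c) (Box \<psi>) \<in> T" using IntK_mono IntK_subset by blast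
  then have "U (Box (Imp \<phi> \<psi>)) \<inter> U (Box \<phi>) \<subseteq> U (Box \<psi>)"
    using U_subset_iff U_Box_Conj by metis
  moreover have "U (Box (Imp \<phi> \<psi>)) = U Top"
    using assms U_subset_iff U_eq_Top_iff nec by blast
  ultimately show ?thesis using truth_set_subset_Top by blast
qed

lemma U_Box_cong: "U \<phi> = U \<psi> \<Longrightarrow> U (Box \<phi>) = U (Box \<psi>)"
  using U_Box_mono by blast

lemma U_Imp_cong: "U \<phi> = U \<phi>' \<Longrightarrow> U \<psi> = U \<psi>' \<Longrightarrow> U (Imp \<phi> \<psi>) = U (Imp \<phi>' \<psi>')"
  using U_residual by (metis subset_antisym order_refl)

end

lemma modal_theory_of_obeys:
  assumes S: "consequence_relation S" and T: "\<forall>r\<in>S. obeys T r"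
  shows "modal_theory T"
proof
  have resp: "D \<inter> T \<noteq> {}" if "(G, D) \<in> S" "G \<subseteq> T" for G D
    using T that unfolding obeys_def by force
  show "IntK \<subseteq> T" using resp[OF cr_IntK[OF S]] by blast
  show "\<psi> \<in> T" if "Imp \<phi> \<psi> \<in> T" "\<phi> \<in> T" for \<phi> \<psi>
    using resp[OF cr_mp[OF S, of \<phi> \<psi>]] that by blast
  show "Box \<phi> \<in> T" if "\<phi> \<in> T" for \<phi>
    using resp[OF cr_nec[OF S, of \<phi>]] that by blast
qed


section \<open>From a finite lattice of sets to a modal Heyting algebra\<close>

text \<open>The bijection \<open>d\<close> numbers the members of the lattice, so that the algebra built below has
  natural numbers as elements. The operator \<open>bx\<close> may lead out of the lattice.\<close>

locale finite_set_lattice =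
  fixes A :: "'w set set" and W :: "'w set" and n :: nat and d :: "nat \<Rightarrow> 'w set"
    and bx :: "'w set \<Rightarrow> 'w set"
  assumes d_bij: "bij_betw d {..<n} A"
    and empty_mem: "{} \<in> A" and W_mem: "W \<in> A"
    and Int_mem: "X \<in> A \<Longrightarrow> Y \<in> A \<Longrightarrow> X \<inter> Y \<in> A"
    and Un_mem: "X \<in> A \<Longrightarrow> Y \<in> A \<Longrightarrow> X \<union> Y \<in> A"
    and subset_W: "X \<in> A \<Longrightarrow> X \<subseteq> W"
    and bx_W: "bx W = W"
    and bx_Int: "X \<in> A \<Longrightarrow> Y \<in> A \<Longrightarrow> bx (X \<inter> Y) = bx X \<inter> bx Y"
begin

definition e :: "'w set \<Rightarrow> nat" where "e = inv_into {..<n} d"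

definition interior :: "'w set \<Rightarrow> 'w set" where "interior X = \<Union>{C \<in> A. C \<subseteq> X}"

definition alg :: "nat modal_alg" where
  "alg = \<lparr>carrier = {..<n}, eq = (=), le = (\<lambda>i j. d i \<subseteq> d j),
     himp = (\<lambda>i j. e (interior (- d i \<union> d j))), hbox = (\<lambda>i. e (interior (bx (d i))))\<rparr>"

lemma finite_A: "finite A"
  using bij_betw_finite[OF d_bij] by simp

lemma d_mem: "i < n \<Longrightarrow> d i \<in> A"
  using d_bij bij_betwE by blast

lemma d_inj: "i < n \<Longrightarrow> j < n \<Longrightarrow> d i = d j \<longleftrightarrow> i = j"
  using d_bij by (meson bij_betw_imp_inj_on inj_on_eq_iff lessThan_iff)

lemma d_e: "X \<in> A \<Longrightarrow> d (e X) = X"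
  unfolding e_def using d_bij by (simp add: bij_betw_inv_into_right)

lemma e_less: "X \<in> A \<Longrightarrow> e X < n"
  unfolding e_def using d_bij by (metis bij_betw_def inv_into_into lessThan_iff)

lemma Union_mem:
  assumes "F \<subseteq> A" shows "\<Union>F \<in> A"
proof -
  have "finite F" using assms finite_A finite_subset by blast
  then show ?thesis using assms by induction (auto simp: empty_mem Un_mem)
qed

lemma interior_mem: "interior X \<in> A"
  unfolding interior_def by (rule Union_mem) blast

lemma subset_interior_iff: "C \<in> A \<Longrightarrow> C \<subseteq> interior X \<longleftrightarrow> C \<subseteq> X"
  unfolding interior_def by blast

lemma interior_id: "X \<in> A \<Longrightarrow> interior X = X"
  unfolding interior_def by blast

lemma interior_subset: "interior X \<subseteq> X"
  unfolding interior_def by blast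

lemma interior_Int: "interior (X \<inter> Y) = interior X \<inter> interior Y"
proof -
  have "interior X \<inter> interior Y \<subseteq> interior (X \<inter> Y)"
    using subset_interior_iff[OF Int_mem[OF interior_mem interior_mem], of X Y "X \<inter> Y"]
      interior_subset[of X] interior_subset[of Y] by blast
  then show ?thesis unfolding interior_def by blast
qed

lemma alg_carrier [simp]: "carrier alg = {..<n}"
  and alg_le [simp]: "i \<sqsubseteq>\<^bsub>alg\<^esub> j \<longleftrightarrow> d i \<subseteq> d j"
  and alg_eq [simp]: "i .=\<^bsub>alg\<^esub> j \<longleftrightarrow> i = j"
  unfolding alg_def by simp_all

lemma d_himp: "d (himp alg i j) = interior (- d i \<union> d j)"
  unfolding alg_def by (simp add: d_e interior_mem)

lemma d_hbox: "d (hbox alg i) = interior (bx (d i))"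
  unfolding alg_def by (simp add: d_e interior_mem)

lemma himp_less: "himp alg i j < n" and hbox_less: "hbox alg i < n"
  unfolding alg_def by (simp_all add: e_less interior_mem)

lemma partial_order_alg: "partial_order alg"
  by unfold_locales (auto simp: d_inj[symmetric] alg_def)

lemma bounded_lattice_alg: "bounded_lattice alg"
proof -
  interpret partial_order alg by (rule partial_order_alg)
  show ?thesis
  proof
    fix x y assume xy: "x \<in> carrier alg" "y \<in> carrier alg"
    have "least alg (e (d x \<union> d y)) (Upper alg {x, y})"
      unfolding least_def Upper_def using xy
      by (auto simp: d_e e_less Un_mem d_mem)
    then show "\<exists>s. least alg s (Upper alg {x, y})" by blast
    have "greatest alg (e (d x \<inter> d y)) (Lower alg {x, y})"
      unfolding greatest_def Lower_def using xy
      by (auto simp: d_e e_less Int_mem d_mem)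
    then show "\<exists>s. greatest alg s (Lower alg {x, y})" by blast
  next
    have "least alg (e {}) (carrier alg)"
      unfolding least_def by (auto simp: d_e e_less empty_mem)
    then show "\<exists>x. least alg x (carrier alg)" by blast
    have "greatest alg (e W) (carrier alg)"
      unfolding greatest_def using subset_W d_mem by (auto simp: d_e e_less W_mem)
    then show "\<exists>x. greatest alg x (carrier alg)" by blast
  qed
qed

sublocale bl: bounded_lattice alg by (rule bounded_lattice_alg)

lemma join_less: "i < n \<Longrightarrow> j < n \<Longrightarrow> i \<squnion>\<^bsub>alg\<^esub> j < n"
  and meet_less: "i < n \<Longrightarrow> j < n \<Longrightarrow> i \<sqinter>\<^bsub>alg\<^esub> j < n"
  and top_less: "\<top>\<^bsub>alg\<^esub> < n" and bottom_less: "\<bottom>\<^bsub>alg\<^esub> < n"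
  using bl.join_closed[of i j] bl.meet_closed[of i j] bl.top_closed bl.bottom_closed by simp_all

lemma d_join:
  assumes "i < n" "j < n"
  shows "d (i \<squnion>\<^bsub>alg\<^esub> j) = d i \<union> d j"
proof
  have "i \<squnion>\<^bsub>alg\<^esub> j \<sqsubseteq>\<^bsub>alg\<^esub> e (d i \<union> d j)"
    by (rule bl.join_le) (use assms in \<open>auto simp: d_e e_less Un_mem d_mem\<close>)
  then show "d (i \<squnion>\<^bsub>alg\<^esub> j) \<subseteq> d i \<union> d j" using assms by (simp add: d_e Un_mem d_mem)
  show "d i \<union> d j \<subseteq> d (i \<squnion>\<^bsub>alg\<^esub> j)"
    using bl.join_left[of i j] bl.join_right[of i j] assms by auto
qed

lemma d_meet:
  assumes "i < n" "j < n"
  shows "d (i \<sqinter>\<^bsub>alg\<^esub> j) = d i \<inter> d j"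
proof
  have "e (d i \<inter> d j) \<sqsubseteq>\<^bsub>alg\<^esub> i \<sqinter>\<^bsub>alg\<^esub> j"
    by (rule bl.meet_le) (use assms in \<open>auto simp: d_e e_less Int_mem d_mem\<close>)
  then show "d i \<inter> d j \<subseteq> d (i \<sqinter>\<^bsub>alg\<^esub> j)" using assms by (simp add: d_e Int_mem d_mem)
  show "d (i \<sqinter>\<^bsub>alg\<^esub> j) \<subseteq> d i \<inter> d j"
    using bl.meet_left[of i j] bl.meet_right[of i j] assms by auto
qed

lemma d_top: "d \<top>\<^bsub>alg\<^esub> = W"
  using bl.top_higher[of "e W"] subset_W[OF d_mem[OF top_less]] by (auto simp: d_e e_less W_mem)

lemma d_bottom: "d \<bottom>\<^bsub>alg\<^esub> = {}"
  using bl.bottom_lower[of "e {}"] by (auto simp: d_e e_less empty_mem)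

text \<open>The interior is right adjoint to the inclusion of the lattice into all sets. This gives the
  residuation law, and it makes the interior preserve intersections, hence the box preserve meets.\<close>

lemma modal_heyting_algebra_alg: "modal_heyting_algebra alg"
proof
  fix a b c assume abc: "a \<in> carrier alg" "b \<in> carrier alg" "c \<in> carrier alg"
  then show "c \<sqsubseteq>\<^bsub>alg\<^esub> himp alg a b \<longleftrightarrow> c \<sqinter>\<^bsub>alg\<^esub> a \<sqsubseteq>\<^bsub>alg\<^esub> b"
    by (auto simp: d_himp d_meet subset_interior_iff d_mem)
next
  fix a b assume "a \<in> carrier alg" "b \<in> carrier alg"
  then show "hbox alg (a \<sqinter>\<^bsub>alg\<^esub> b) = hbox alg a \<sqinter>\<^bsub>alg\<^esub> hbox alg b"
    by (simp add: d_inj[symmetric] hbox_less meet_less d_meet d_hbox bx_Int d_mem interior_Int)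
next
  show "hbox alg \<top>\<^bsub>alg\<^esub> = \<top>\<^bsub>alg\<^esub>"
    by (simp add: d_inj[symmetric] hbox_less top_less d_top d_hbox bx_W interior_id W_mem)
qed (simp_all add: himp_less hbox_less)

end


section \<open>Transfer of refutations\<close>

primrec subformulas :: "fm \<Rightarrow> fm set" where
  "subformulas (Var p) = {Var p}"
| "subformulas (Conj \<phi> \<psi>) = {Conj \<phi> \<psi>} \<union> subformulas \<phi> \<union> subformulas \<psi>"
| "subformulas (Disj \<phi> \<psi>) = {Disj \<phi> \<psi>} \<union> subformulas \<phi> \<union> subformulas \<psi>"
| "subformulas (Imp \<phi> \<psi>) = {Imp \<phi> \<psi>} \<union> subformulas \<phi> \<union> subformulas \<psi>"
| "subformulas Top = {Top}"
| "subformulas Bot = {Bot}"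
| "subformulas (Box \<phi>) = {Box \<phi>} \<union> subformulas \<phi>"

lemma subformulas_self: "\<phi> \<in> subformulas \<phi>"
  by (cases \<phi>) auto

lemma finite_subformulas: "finite (subformulas \<phi>)"
  by (induction \<phi>) auto

lemma subformulas_trans: "\<psi> \<in> subformulas \<phi> \<Longrightarrow> subformulas \<psi> \<subseteq> subformulas \<phi>"
  by (induction \<phi>) auto

definition subformula_closed :: "fm set \<Rightarrow> bool" where
  "subformula_closed \<Theta> \<longleftrightarrow> (\<forall>\<phi>\<in>\<Theta>. subformulas \<phi> \<subseteq> \<Theta>)"

text \<open>Implications and boxes may be met only at arguments in \<open>D\<^sup>\<rightarrow>\<close> and \<open>D\<^sup>\<box>\<close>, so that the premises of the
  stable canonical rule describe every step of the evaluation of a formula in \<open>\<Theta>\<close>.\<close>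

definition local_valuation ::
    "fm set \<Rightarrow> (fm \<Rightarrow> 'a) \<Rightarrow> 'a modal_alg \<Rightarrow> ('a \<times> 'a) set \<Rightarrow> 'a set \<Rightarrow> bool" where
  "local_valuation \<Theta> h L Dimp Dbox \<longleftrightarrow>
     (\<forall>\<phi>\<in>\<Theta>. h \<phi> \<in> carrier L) \<and>
     (\<forall>\<phi> \<psi>. Conj \<phi> \<psi> \<in> \<Theta> \<longrightarrow> h (Conj \<phi> \<psi>) = h \<phi> \<sqinter>\<^bsub>L\<^esub> h \<psi>) \<and>
     (\<forall>\<phi> \<psi>. Disj \<phi> \<psi> \<in> \<Theta> \<longrightarrow> h (Disj \<phi> \<psi>) = h \<phi> \<squnion>\<^bsub>L\<^esub> h \<psi>) \<and>
     (\<forall>\<phi> \<psi>. Imp \<phi> \<psi> \<in> \<Theta> \<longrightarrow> h (Imp \<phi> \<psi>) = himp L (h \<phi>) (h \<psi>) \<and> (h \<phi>, h \<psi>) \<in> Dimp) \<and>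
     (\<forall>\<phi>. Box \<phi> \<in> \<Theta> \<longrightarrow> h (Box \<phi>) = hbox L (h \<phi>) \<and> h \<phi> \<in> Dbox) \<and>
     (Top \<in> \<Theta> \<longrightarrow> h Top = \<top>\<^bsub>L\<^esub>) \<and> (Bot \<in> \<Theta> \<longrightarrow> h Bot = \<bottom>\<^bsub>L\<^esub>)"

text \<open>The rule \<open>\<Gamma>/\<Delta>\<close> derives the stable canonical rule of every algebra in which \<open>h\<close> refutes it.
  In a theory refuting the stable rule, the substitution sending each letter to the letter
  of its value makes every \<open>\<phi> \<in> \<Theta>\<close> equivalent to the letter of \<open>h \<phi>\<close>. The members of \<open>\<Gamma>\<close> thereby
  become true, whereas those of \<open>\<Delta>\<close> fail because letters of different elements
  are inequivalent.\<close>

lemma stable_rule_from_rule: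
  assumes S: "consequence_relation S" and r: "(\<Gamma>, \<Delta>) \<in> S"
    and closed: "subformula_closed \<Theta>" and sub: "\<Gamma> \<subseteq> \<Theta>" "\<Delta> \<subseteq> \<Theta>"
    and h: "local_valuation \<Theta> h L Dimp Dbox"
    and top: "\<top>\<^bsub>L\<^esub> \<in> carrier L"
    and valG: "\<And>\<phi>. \<phi> \<in> \<Gamma> \<Longrightarrow> h \<phi> = \<top>\<^bsub>L\<^esub>" and valD: "\<And>\<phi>. \<phi> \<in> \<Delta> \<Longrightarrow> h \<phi> \<noteq> \<top>\<^bsub>L\<^esub>"
    and fin: "finite (stable_premises p L Dimp Dbox)" "finite (stable_conclusions p L)"
  shows "stable_canonical_rule p L Dimp Dbox \<in> S"
proof (rule ccontr)
  assume "stable_canonical_rule p L Dimp Dbox \<notin> S"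
  then obtain T where T: "\<forall>r\<in>S. obeys T r" "stable_premises p L Dimp Dbox \<subseteq> T"
      "stable_conclusions p L \<inter> T = {}"
    using refuting_theory[OF S fin] unfolding stable_canonical_rule_def by metis
  interpret modal_theory T using modal_theory_of_obeys[OF S T(1)] .
  define s where "s q = Var (p (h (Var q)))" for q
  let ?v = "\<lambda>a. U (Var (p a))"
  note hD = h[unfolded local_valuation_def]
  have prem: "\<phi> \<in> T" if "\<phi> \<in> stable_premises p L Dimp Dbox" for \<phi> using T(2) that by blast
  have v_join: "?v (a \<squnion>\<^bsub>L\<^esub> b) = ?v a \<union> ?v b" if "a \<in> carrier L" "b \<in> carrier L" for a b
    unfolding truth_set_Disj[symmetric] U_eq_iff
    by (rule prem) (use that in \<open>unfold stable_premises_def, blast\<close>)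
  have v_meet: "?v (a \<sqinter>\<^bsub>L\<^esub> b) = ?v a \<inter> ?v b" if "a \<in> carrier L" "b \<in> carrier L" for a b
    unfolding truth_set_Conj[symmetric] U_eq_iff
    by (rule prem) (use that in \<open>unfold stable_premises_def, blast\<close>)
  have v_top: "?v \<top>\<^bsub>L\<^esub> = U Top" and v_bot: "?v \<bottom>\<^bsub>L\<^esub> = U Bot"
    unfolding U_eq_iff by (rule prem, unfold stable_premises_def, blast)+
  have v_imp: "?v (himp L a b) = U (Imp (Var (p a)) (Var (p b)))" if "(a, b) \<in> Dimp" for a b
    unfolding U_eq_iff by (rule prem) (use that in \<open>unfold stable_premises_def, blast\<close>)
  have v_box: "?v (hbox L a) = U (Box (Var (p a)))" if "a \<in> carrier L" "a \<in> Dbox" for a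
    unfolding set_eq_subset U_subset_iff
    by (intro conjI; rule prem) (use that in \<open>unfold stable_premises_def, blast+\<close>)
  have main: "\<phi> \<in> \<Theta> \<Longrightarrow> U (subst s \<phi>) = ?v (h \<phi>)" for \<phi>
  proof (induction \<phi>)
    case (Var q)
    then show ?case by (simp add: s_def)
  next
    case (Conj \<phi> \<psi>)
    then have "\<phi> \<in> \<Theta>" "\<psi> \<in> \<Theta>"
      using closed subformulas_self unfolding subformula_closed_def by fastforce+
    then show ?case using Conj hD v_meet by (simp add: truth_set_Conj)
  next
    case (Disj \<phi> \<psi>)
    then have "\<phi> \<in> \<Theta>" "\<psi> \<in> \<Theta>"
      using closed subformulas_self unfolding subformula_closed_def by fastforce+
    then show ?case using Disj hD v_join by (simp add: truth_set_Disj)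
  next
    case (Imp \<phi> \<psi>)
    then have "\<phi> \<in> \<Theta>" "\<psi> \<in> \<Theta>"
      using closed subformulas_self unfolding subformula_closed_def by fastforce+
    then show ?case
      using Imp hD v_imp U_Imp_cong[of "subst s \<phi>" _ "subst s \<psi>"] by simp
  next
    case (Box \<phi>)
    then have "\<phi> \<in> \<Theta>"
      using closed subformulas_self unfolding subformula_closed_def by fastforce
    then show ?case using Box hD v_box U_Box_cong[of "subst s \<phi>"] by simp
  qed (use hD v_top v_bot in simp_all)
  have "subst s \<phi> \<in> T" if "\<phi> \<in> \<Gamma>" for \<phi>
    using main valG v_top U_eq_Top_iff sub that by (metis subsetD)
  moreover have "subst s \<phi> \<notin> T" if "\<phi> \<in> \<Delta>" for \<phi>
  proof
    assume "subst s \<phi> \<in> T"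
    then have "?v (h \<phi>) = ?v \<top>\<^bsub>L\<^esub>" using main v_top U_eq_Top_iff sub that by (metis subsetD)
    then have "Iff (Var (p (h \<phi>))) (Var (p \<top>\<^bsub>L\<^esub>)) \<in> T" unfolding U_eq_iff .
    moreover have "Iff (Var (p (h \<phi>))) (Var (p \<top>\<^bsub>L\<^esub>)) \<in> stable_conclusions p L"
      unfolding stable_conclusions_def using hD sub that top valD by blast
    ultimately show False using T(3) by blast
  qed
  moreover have "obeys T (subst s ` \<Gamma>, subst s ` \<Delta>)"
    using T(1) cr_subst[OF S r] by blast
  ultimately show False unfolding obeys_def by auto
qed

lemma finite_stable_canonical_rule:
  assumes "finite (carrier L)" "Dimp \<subseteq> carrier L \<times> carrier L" "Dbox \<subseteq> carrier L"
  shows "finite (stable_premises p L Dimp Dbox)" "finite (stable_conclusions p L)"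
proof -
  let ?A = "carrier L"
  have fin: "finite Dimp" "finite Dbox" using assms finite_subset by blast+
  have "stable_premises p L Dimp Dbox =
      (\<lambda>(a, b). Iff (Var (p (a \<squnion>\<^bsub>L\<^esub> b))) (Disj (Var (p a)) (Var (p b)))) ` (?A \<times> ?A) \<union>
      (\<lambda>(a, b). Iff (Var (p (a \<sqinter>\<^bsub>L\<^esub> b))) (Conj (Var (p a)) (Var (p b)))) ` (?A \<times> ?A) \<union>
      {Iff (Var (p \<bottom>\<^bsub>L\<^esub>)) Bot, Iff (Var (p \<top>\<^bsub>L\<^esub>)) Top} \<union>
      (\<lambda>a. Imp (Var (p (hbox L a))) (Box (Var (p a)))) ` ?A \<union>
      (\<lambda>(a, b). Iff (Var (p (himp L a b))) (Imp (Var (p a)) (Var (p b)))) ` Dimp \<union>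
      (\<lambda>a. Imp (Box (Var (p a))) (Var (p (hbox L a)))) ` Dbox"
    unfolding stable_premises_def by (intro arg_cong2[where f = "(\<union>)"] refl) (auto simp: image_iff)
  then show "finite (stable_premises p L Dimp Dbox)" using assms(1) fin by simp
  have "stable_conclusions p L \<subseteq> (\<lambda>(a, b). Iff (Var (p a)) (Var (p b))) ` (?A \<times> ?A)"
    unfolding stable_conclusions_def by (auto simp: image_iff)
  then show "finite (stable_conclusions p L)" using assms(1) finite_subset by blast
qed


section \<open>The finite sublattice generated by the subformulas\<close>

inductive_set lattice_closure :: "fm set \<Rightarrow> fm set" for \<Theta> where
  gen: "\<phi> \<in> \<Theta> \<Longrightarrow> \<phi> \<in> lattice_closure \<Theta>"
| top: "Top \<in> lattice_closure \<Theta>"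
| bot: "Bot \<in> lattice_closure \<Theta>"
| conj: "\<phi> \<in> lattice_closure \<Theta> \<Longrightarrow> \<psi> \<in> lattice_closure \<Theta> \<Longrightarrow> Conj \<phi> \<psi> \<in> lattice_closure \<Theta>"
| disj: "\<phi> \<in> lattice_closure \<Theta> \<Longrightarrow> \<psi> \<in> lattice_closure \<Theta> \<Longrightarrow> Disj \<phi> \<psi> \<in> lattice_closure \<Theta>"

text \<open>Whether a prime theory contains a lattice combination of formulas of \<open>\<Theta>\<close> depends only on
  its trace on \<open>\<Theta>\<close>, and there are finitely many sets of traces.\<close>

lemma finite_truth_sets_lattice_closure:
  assumes "finite \<Theta>"
  shows "finite (truth_set T ` lattice_closure \<Theta>)"
proof (rule finite_subset)
  let ?t = "\<lambda>X. {Q. prime_theory Q \<and> T \<subseteq> Q \<and> Q \<inter> \<Theta> \<in> X}"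
  have "\<exists>X \<in> Pow (Pow \<Theta>). truth_set T \<phi> = ?t X" if "\<phi> \<in> lattice_closure \<Theta>" for \<phi>
    using that
  proof induction
    case (gen \<phi>)
    then show ?case
      by (intro bexI[of _ "{Y \<in> Pow \<Theta>. \<phi> \<in> Y}"]) (auto simp: truth_set_def)
  next
    case top
    show ?case
      by (intro bexI[of _ "Pow \<Theta>"])
        (auto simp: truth_set_def prime_theory_def intro: ipc_theory_axiom ipc_axioms.intros)
  next
    case bot
    show ?case by (intro bexI[of _ "{}"]) (auto simp: truth_set_Bot)
  next
    case (conj \<phi> \<psi>)
    obtain X where "X \<in> Pow (Pow \<Theta>)" "truth_set T \<phi> = ?t X" using conj.IH(1) ..
    moreover obtain Y where "Y \<in> Pow (Pow \<Theta>)" "truth_set T \<psi> = ?t Y" using conj.IH(2) ..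
    ultimately show ?case by (intro bexI[of _ "X \<inter> Y"]) (auto simp: truth_set_Conj)
  next
    case (disj \<phi> \<psi>)
    obtain X where "X \<in> Pow (Pow \<Theta>)" "truth_set T \<phi> = ?t X" using disj.IH(1) ..
    moreover obtain Y where "Y \<in> Pow (Pow \<Theta>)" "truth_set T \<psi> = ?t Y" using disj.IH(2) ..
    ultimately show ?case by (intro bexI[of _ "X \<union> Y"]) (auto simp: truth_set_Disj)
  qed
  then show "truth_set T ` lattice_closure \<Theta> \<subseteq> ?t ` Pow (Pow \<Theta>)"
    by (intro image_subsetI) (unfold image_iff)
  show "finite (?t ` Pow (Pow \<Theta>))" using assms by simp
qed

text \<open>The finite algebra is the sublattice of truth sets generated by \<open>\<Theta>\<close>, and its elements serve
  as their own letters. Replacing each of these letters by a formula with that truth set refutes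
  the stable canonical rule in \<open>T\<close>, provided that \<open>D\<^sup>\<rightarrow>\<close> and \<open>D\<^sup>\<box>\<close> contain only those arguments
  where the operations of the finite algebra agree with the ones of \<open>T\<close>.\<close>

lemma (in modal_theory) refuted_stable_rule:
  assumes fin: "finite \<Theta>" and closed: "subformula_closed \<Theta>"
  obtains L :: "nat modal_alg" and Dimp Dbox h s where
    "modal_heyting_algebra L" "finite (carrier L)"
    "Dimp \<subseteq> carrier L \<times> carrier L" "Dbox \<subseteq> carrier L"
    "local_valuation \<Theta> h L Dimp Dbox"
    "\<And>\<phi>. \<phi> \<in> \<Theta> \<Longrightarrow> h \<phi> = \<top>\<^bsub>L\<^esub> \<longleftrightarrow> \<phi> \<in> T"
    "\<not> obeys T (subst s ` stable_premises id L Dimp Dbox, subst s ` stable_conclusions id L)"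
proof -
  let ?B = "lattice_closure \<Theta>"
  let ?A = "U ` ?B"
  have "finite ?A" by (rule finite_truth_sets_lattice_closure[OF fin])
  then obtain d where d: "bij_betw d {..<card ?A} ?A"
    using ex_bij_betw_nat_finite[of ?A] by (metis atLeast0LessThan)
  (* U (Box \<phi>) depends on U \<phi> only, so if X is a truth set, then all members of the union are equal *)
  define bx where "bx X = \<Union>{U (Box \<phi>) |\<phi>. U \<phi> = X}" for X
  have bx: "bx (U \<phi>) = U (Box \<phi>)" for \<phi>
    unfolding bx_def using U_Box_cong by blast
  interpret FL: finite_set_lattice ?A "U Top" "card ?A" d bx
  proof
    show "bij_betw d {..<card ?A} ?A" by (rule d)
    show "{} \<in> ?A" using lattice_closure.bot truth_set_Bot by (metis imageI)
    show "U Top \<in> ?A" by (intro imageI lattice_closure.top)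
    show "bx (U Top) = U Top" by (simp add: bx U_Box_Top)
    fix X Y assume "X \<in> ?A" "Y \<in> ?A"
    then obtain \<phi> \<psi> where *: "\<phi> \<in> ?B" "\<psi> \<in> ?B" "X = U \<phi>" "Y = U \<psi>" by blast
    show "X \<inter> Y \<in> ?A" using * lattice_closure.conj truth_set_Conj by (metis imageI)
    show "X \<union> Y \<in> ?A" using * lattice_closure.disj truth_set_Disj by (metis imageI)
    show "bx (X \<inter> Y) = bx X \<inter> bx Y"
      unfolding * truth_set_Conj[symmetric] by (simp add: bx U_Box_Conj)
  qed (use truth_set_subset_Top in blast)
  let ?L = "FL.alg" and ?n = "card ?A"
  have "\<forall>i\<in>{..<?n}. \<exists>\<phi>. U \<phi> = d i" using FL.d_mem by (metis imageE lessThan_iff)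
  then obtain f where f: "\<And>i. i < ?n \<Longrightarrow> U (f i) = d i" by (metis lessThan_iff)
  define Dimp where
    "Dimp = {(i, j). i < ?n \<and> j < ?n \<and> d (himp ?L i j) = U (Imp (f i) (f j))}"
  define Dbox where "Dbox = {i. i < ?n \<and> d (hbox ?L i) = U (Box (f i))}"
  define h where "h \<phi> = FL.e (U \<phi>)" for \<phi>
  have mem: "U \<phi> \<in> ?A" if "\<phi> \<in> \<Theta>" for \<phi> using that lattice_closure.gen by blast
  have h_less: "h \<phi> < ?n" and dh: "d (h \<phi>) = U \<phi>" if "\<phi> \<in> \<Theta>" for \<phi>
    using mem[OF that] by (simp_all add: h_def FL.e_less FL.d_e)
  have fh: "U (f (h \<phi>)) = U \<phi>" if "\<phi> \<in> \<Theta>" for \<phi>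
    using that f h_less dh by simp
  have h_eqI: "h \<phi> = i" if "\<phi> \<in> \<Theta>" "i < ?n" "d i = U \<phi>" for \<phi> i
    using that dh h_less FL.d_inj by metis
  have sub: "\<phi> \<in> \<Theta>" "\<psi> \<in> \<Theta>" if "Conj \<phi> \<psi> \<in> \<Theta> \<or> Disj \<phi> \<psi> \<in> \<Theta> \<or> Imp \<phi> \<psi> \<in> \<Theta>" for \<phi> \<psi>
    using that closed subformulas_self unfolding subformula_closed_def by fastforce+
  have subB: "\<phi> \<in> \<Theta>" if "Box \<phi> \<in> \<Theta>" for \<phi>
    using that closed subformulas_self unfolding subformula_closed_def by fastforce
  have val: "local_valuation \<Theta> h ?L Dimp Dbox"
    unfolding local_valuation_def
  proof (intro conjI allI ballI impI)
    fix \<phi> assume "\<phi> \<in> \<Theta>"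
    then show "h \<phi> \<in> carrier ?L" using h_less by simp
  next
    fix \<phi> \<psi> assume *: "Conj \<phi> \<psi> \<in> \<Theta>"
    then have "\<phi> \<in> \<Theta>" "\<psi> \<in> \<Theta>" using sub by blast+
    then show "h (Conj \<phi> \<psi>) = h \<phi> \<sqinter>\<^bsub>?L\<^esub> h \<psi>"
      by (intro h_eqI *) (simp_all add: FL.meet_less h_less FL.d_meet dh truth_set_Conj)
  next
    fix \<phi> \<psi> assume *: "Disj \<phi> \<psi> \<in> \<Theta>"
    then have "\<phi> \<in> \<Theta>" "\<psi> \<in> \<Theta>" using sub by blast+
    then show "h (Disj \<phi> \<psi>) = h \<phi> \<squnion>\<^bsub>?L\<^esub> h \<psi>"
      by (intro h_eqI *) (simp_all add: FL.join_less h_less FL.d_join dh truth_set_Disj)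
  next
    fix \<phi> \<psi> assume *: "Imp \<phi> \<psi> \<in> \<Theta>"
    then have **: "\<phi> \<in> \<Theta>" "\<psi> \<in> \<Theta>" using sub by blast+
    have "C \<subseteq> - U \<phi> \<union> U \<psi> \<longleftrightarrow> C \<subseteq> U (Imp \<phi> \<psi>)" if "C \<in> ?A" for C
      using that U_residual[of _ \<phi> \<psi>] by blast
    then have "FL.interior (- U \<phi> \<union> U \<psi>) = FL.interior (U (Imp \<phi> \<psi>))"
      unfolding FL.interior_def by (metis (no_types, lifting))
    then have himp: "d (himp ?L (h \<phi>) (h \<psi>)) = U (Imp \<phi> \<psi>)"
      using FL.interior_id[OF mem[OF *]] by (simp add: FL.d_himp dh **)
    show "h (Imp \<phi> \<psi>) = himp ?L (h \<phi>) (h \<psi>)"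
      by (rule h_eqI[OF * FL.himp_less himp])
    show "(h \<phi>, h \<psi>) \<in> Dimp"
      unfolding Dimp_def using himp h_less ** U_Imp_cong[OF fh fh] by simp
  next
    fix \<phi> assume *: "Box \<phi> \<in> \<Theta>"
    then have **: "\<phi> \<in> \<Theta>" by (rule subB)
    have hbox: "d (hbox ?L (h \<phi>)) = U (Box \<phi>)"
      by (simp add: FL.d_hbox dh ** bx FL.interior_id mem *)
    show "h (Box \<phi>) = hbox ?L (h \<phi>)"
      by (rule h_eqI[OF * FL.hbox_less hbox])
    show "h \<phi> \<in> Dbox"
      unfolding Dbox_def using hbox h_less ** U_Box_cong[OF fh] by simp
  next
    assume "Top \<in> \<Theta>"
    then show "h Top = \<top>\<^bsub>?L\<^esub>" by (rule h_eqI) (simp_all add: FL.top_less FL.d_top)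
  next
    assume "Bot \<in> \<Theta>"
    then show "h Bot = \<bottom>\<^bsub>?L\<^esub>"
      by (rule h_eqI) (simp_all add: FL.bottom_less FL.d_bottom truth_set_Bot)
  qed
  have top: "h \<phi> = \<top>\<^bsub>?L\<^esub> \<longleftrightarrow> \<phi> \<in> T" if "\<phi> \<in> \<Theta>" for \<phi>
    using that h_less dh FL.top_less FL.d_top FL.d_inj U_eq_Top_iff by metis
  have Iff_T: "subst f (Iff \<phi> \<psi>) \<in> T" if "U (subst f \<phi>) = U (subst f \<psi>)" for \<phi> \<psi>
    using that unfolding U_eq_iff by (simp add: Iff_def)
  have Imp_T: "subst f (Imp \<phi> \<psi>) \<in> T" if "U (subst f \<phi>) \<subseteq> U (subst f \<psi>)" for \<phi> \<psi>
    using that unfolding U_subset_iff by simp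
  have "subst f \<chi> \<in> T" if "\<chi> \<in> stable_premises id ?L Dimp Dbox" for \<chi>
  proof -
    from that consider
        (join) a b where "a < ?n" "b < ?n" "\<chi> = Iff (Var (a \<squnion>\<^bsub>?L\<^esub> b)) (Disj (Var a) (Var b))"
      | (meet) a b where "a < ?n" "b < ?n" "\<chi> = Iff (Var (a \<sqinter>\<^bsub>?L\<^esub> b)) (Conj (Var a) (Var b))"
      | (bottom) "\<chi> = Iff (Var \<bottom>\<^bsub>?L\<^esub>) Bot"
      | (top) "\<chi> = Iff (Var \<top>\<^bsub>?L\<^esub>) Top"
      | (box) a where "a < ?n" "\<chi> = Imp (Var (hbox ?L a)) (Box (Var a))"
      | (imp) a b where "(a, b) \<in> Dimp" "\<chi> = Iff (Var (himp ?L a b)) (Imp (Var a) (Var b))"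
      | (dbox) a where "a \<in> Dbox" "\<chi> = Imp (Box (Var a)) (Var (hbox ?L a))"
      unfolding stable_premises_def by auto
    then show ?thesis
    proof cases
      case join
      show ?thesis unfolding join(3)
        by (rule Iff_T) (simp add: f join FL.join_less FL.d_join truth_set_Disj)
    next
      case meet
      show ?thesis unfolding meet(3)
        by (rule Iff_T) (simp add: f meet FL.meet_less FL.d_meet truth_set_Conj)
    next
      case bottom
      show ?thesis unfolding bottom
        by (rule Iff_T) (simp add: f FL.bottom_less FL.d_bottom truth_set_Bot)
    next
      case top
      show ?thesis unfolding top by (rule Iff_T) (simp add: f FL.top_less FL.d_top)
    next
      case box
      have "d (hbox ?L a) \<subseteq> U (Box (f a))"
        unfolding FL.d_hbox f[OF box(1), symmetric] bx by (rule FL.interior_subset)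
      then show ?thesis unfolding box(2) by (intro Imp_T) (simp add: f FL.hbox_less)
    next
      case imp
      then show ?thesis unfolding imp(2) Dimp_def by (intro Iff_T) (simp add: f FL.himp_less)
    next
      case dbox
      then show ?thesis unfolding dbox(2) Dbox_def by (intro Imp_T) (simp add: f FL.hbox_less)
    qed
  qed
  moreover have "subst f \<chi> \<notin> T" if \<chi>: "\<chi> \<in> stable_conclusions id ?L" for \<chi>
  proof -
    obtain a b where "a < ?n" "b < ?n" "a \<noteq> b" and \<chi>_eq: "\<chi> = Iff (Var a) (Var b)"
      using \<chi> unfolding stable_conclusions_def by auto
    then have "U (f a) \<noteq> U (f b)" using f FL.d_inj by simp
    then show ?thesis unfolding \<chi>_eq U_eq_iff by (simp add: Iff_def)
  qed
  ultimately have ref: "\<not> obeys T (subst f ` stable_premises id ?L Dimp Dbox,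
      subst f ` stable_conclusions id ?L)"
    unfolding obeys_def by auto
  show thesis
    by (rule that[OF FL.modal_heyting_algebra_alg _ _ _ val top ref])
      (auto simp: Dimp_def Dbox_def)
qed


section \<open>Axiomatization by stable canonical rules\<close>

theorem theorem3p8:
  fixes M :: "mrule set"
  assumes "consequence_relation M"
  shows "\<exists>\<Sigma>. \<Sigma> \<subseteq> stable_canonical_rules \<and> M = IntKR \<oplus> \<Sigma>"
proof (intro exI conjI)
  define \<Sigma> where "\<Sigma> = M \<inter> stable_canonical_rules"
  define S where "S = IntKR \<oplus> \<Sigma>"
  have "is_rule r" if "r \<in> IntKR \<union> \<Sigma>" for r
    using that cr_finite[OF assms] cr_finite[OF consequence_relation_IntKR]
    unfolding \<Sigma>_def is_rule_def by (cases r) auto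
  then have S: "consequence_relation S"
    unfolding S_def by (intro consequence_relation_oplus) blast
  have \<Sigma>S: "\<Sigma> \<subseteq> S" unfolding S_def oplus_def by blast
  show "\<Sigma> \<subseteq> stable_canonical_rules" unfolding \<Sigma>_def by blast
  show "M = IntKR \<oplus> \<Sigma>"
    unfolding S_def[symmetric]
  proof
    show "S \<subseteq> M" unfolding S_def IntKR_oplus \<Sigma>_def using assms by blast
    show "M \<subseteq> S"
    proof (clarify, rule ccontr)
      fix \<Gamma> \<Delta> assume r: "(\<Gamma>, \<Delta>) \<in> M" "(\<Gamma>, \<Delta>) \<notin> S"
      have fin: "finite \<Gamma>" "finite \<Delta>" using cr_finite[OF assms r(1)] by auto
      obtain T where T: "\<forall>r\<in>S. obeys T r" "\<Gamma> \<subseteq> T" "\<Delta> \<inter> T = {}"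
        using refuting_theory[OF S fin r(2)] .
      interpret modal_theory T using modal_theory_of_obeys[OF S T(1)] .
      define \<Theta> where "\<Theta> = \<Union>(subformulas ` (\<Gamma> \<union> \<Delta>))"
      have \<Theta>: "finite \<Theta>" "subformula_closed \<Theta>" "\<Gamma> \<subseteq> \<Theta>" "\<Delta> \<subseteq> \<Theta>"
        unfolding \<Theta>_def subformula_closed_def
        using fin finite_subformulas subformulas_self subformulas_trans by blast+
      obtain L :: "nat modal_alg" and Dimp Dbox h s where
        L: "modal_heyting_algebra L" "finite (carrier L)"
          "Dimp \<subseteq> carrier L \<times> carrier L" "Dbox \<subseteq> carrier L"
        and h: "local_valuation \<Theta> h L Dimp Dbox"
        and h_top: "\<And>\<phi>. \<phi> \<in> \<Theta> \<Longrightarrow> h \<phi> = \<top>\<^bsub>L\<^esub> \<longleftrightarrow> \<phi> \<in> T"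
        and ref: "\<not> obeys T
          (subst s ` stable_premises id L Dimp Dbox, subst s ` stable_conclusions id L)"
        using refuted_stable_rule[OF \<Theta>(1,2)] by blast
      let ?\<rho> = "stable_canonical_rule id L Dimp Dbox"
      have "?\<rho> \<notin> S"
        using cr_subst[OF S] T(1) ref unfolding stable_canonical_rule_def by blast
      moreover have "?\<rho> \<in> stable_canonical_rules"
        unfolding stable_canonical_rules_def using L inj_on_id by blast
      moreover have "?\<rho> \<in> M"
      proof (rule stable_rule_from_rule[OF assms r(1) \<Theta>(2-4) h])
        interpret modal_heyting_algebra L by (rule L)
        show "\<top>\<^bsub>L\<^esub> \<in> carrier L" by (rule top_closed)
        show "h \<phi> = \<top>\<^bsub>L\<^esub>" if "\<phi> \<in> \<Gamma>" for \<phi> using h_top \<Theta> T that by blast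
        show "h \<phi> \<noteq> \<top>\<^bsub>L\<^esub>" if "\<phi> \<in> \<Delta>" for \<phi> using h_top \<Theta> T that by blast
      qed (rule finite_stable_canonical_rule[OF L(2-4)])+
      ultimately show False using \<Sigma>S unfolding \<Sigma>_def by blast
    qed
  qed
qed

end
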